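(* Let $X$ be a real Hilbert space, let $I=\{1,\dots,m\}$ with $m\ge 1$, and for each $i\in I$ let $f_i\colon X\to\mathbb{R}$ be convex and continuous. Let $C:=\{x\in X : f_i(x)\le 0 \text{ for all } i\in I\}$ be nonempty, and let $L>0$ be such that $\|u\|\le L$ for all $i\in I$, $x\in X$ and $u\in\partial f_i(x)$. Suppose $s\in X$ satisfies $\max_{i\in I} f_i(s)<0$ and set $\sigma:=\min_{i\in I}(-f_i(s))>0$. Let $(\alpha_k)_{k\in\mathbb{N}}$ be a sequence of nonnegative real numbers and set $\delta_k:=\alpha_k(2\sigma-\alpha_kL^2)$ for every $k\in\mathbb{N}$. Suppose that $\delta_k\ge 0$ for every $k\in\mathbb{N}$ and that $\sum_{k=0}^\infty\delta_k=+\infty$. Then, for every starting point $x_0\in X$ and every choice of violated indices and subgradients, the subgradient algorithm with step sizes $(\alpha_k)_{k\in\mathbb{N}}$ finds a point in $C$ after finitely many steps, i.e., there is $K\in\mathbb{N}$ such that the iterate $x_K$ is generated and $x_K\in C$.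
   Context: $\mathbb{N}=\{0,1,2,\dots\}$. The convex subdifferential of $f\colon X\to\mathbb{R}$ at $x$ is $\partial f(x)=\{u\in X : f(x)+\langle y-x,u\rangle\le f(y)\text{ for all }y\in X\}$. Subgradient algorithm: given step sizes $(\alpha_k)_{k\in\mathbb{N}}$ in $[0,+\infty[$ and a starting point $x_0\in X$, proceed as follows for $k=0,1,2,\dots$. If $x_k\in C$, stop. Otherwise, pick any index $i_k\in I$ with $f_{i_k}(x_k)>0$ and any $g_k\in\partial f_{i_k}(x_k)$, and set $x_{k+1}:=x_k-\alpha_kg_k$. *)

theory Defs
  imports "HOL-Analysis.Analysis"
begin

definition subdifferential :: "('a::real_inner \<Rightarrow> real) \<Rightarrow> 'a \<Rightarrow> 'a set" where
  "subdifferential f x = {u. \<forall>y. f x + (y - x) \<bullet> u \<le> f y}"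

definition feasible_set :: "'i set \<Rightarrow> ('i \<Rightarrow> 'a \<Rightarrow> real) \<Rightarrow> 'a set" where
  "feasible_set I f = {x. \<forall>i\<in>I. f i x \<le> 0}"

text \<open>
  The iterates of the algorithm are stored in a total sequence \<open>x :: nat \<Rightarrow> 'a\<close>. Only an initial part
  of it is meaningful: the algorithm stops at the first iterate that lies in \<open>C\<close>, and all later
  entries are arbitrary. The iterate \<open>x k\<close> is generated iff no earlier iterate caused a stop.
\<close>

definition generated :: "'a set \<Rightarrow> (nat \<Rightarrow> 'a) \<Rightarrow> nat \<Rightarrow> bool" where
  "generated C x k \<longleftrightarrow> (\<forall>j<k. x j \<notin> C)"

text \<open>
  \<open>x\<close> is a sequence of iterates of the subgradient algorithm with step sizes \<open>\<alpha>\<close>, starting point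
  \<open>x0\<close>, chosen violated indices \<open>\<iota>\<close> and chosen subgradients \<open>g\<close>. The values \<open>\<iota> k\<close>, \<open>g k\<close> and
  \<open>x (Suc k)\<close> are constrained only if step \<open>k\<close> is carried out.
\<close>

definition subgradient_algorithm ::
  "'i set \<Rightarrow> ('i \<Rightarrow> 'a::real_inner \<Rightarrow> real) \<Rightarrow> (nat \<Rightarrow> real) \<Rightarrow> 'a
    \<Rightarrow> (nat \<Rightarrow> 'i) \<Rightarrow> (nat \<Rightarrow> 'a) \<Rightarrow> (nat \<Rightarrow> 'a) \<Rightarrow> bool" where
  "subgradient_algorithm I f \<alpha> x0 \<iota> g x \<longleftrightarrow>
     x 0 = x0 \<and>
     (\<forall>k. generated (feasible_set I f) x k \<and> x k \<notin> feasible_set I f \<longrightarrow>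
        \<iota> k \<in> I \<and> f (\<iota> k) (x k) > 0 \<and>
        g k \<in> subdifferential (f (\<iota> k)) (x k) \<and>
        x (Suc k) = x k - \<alpha> k *\<^sub>R g k)"

end

theory Submission
  imports Defs
begin

text \<open>
  The strictly feasible point \<open>s\<close> attracts the iterates. As long as the current iterate violates a
  constraint \<open>f\<^sub>i\<close>, the values \<open>f\<^sub>i (x\<^sub>k) > 0\<close> and \<open>f\<^sub>i s \<le> -\<sigma>\<close> differ by more than \<open>\<sigma>\<close>, so the
  subgradient inequality forces the step direction \<open>-g\<^sub>k\<close> to make an angle with \<open>s - x\<^sub>k\<close> that is acute
  in a quantitative way. Expanding the square shows that each step decreases the squared
  distance to \<open>s\<close> by at least \<open>\<delta>\<^sub>k = \<alpha>\<^sub>k (2\<sigma> - \<alpha>\<^sub>k L\<^sup>2)\<close> (lemma \<open>subgradient_step_dist_decrease\<close>).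
  If no iterate were feasible, the partial sums of \<open>\<delta>\<close> would never exceed the initial squared
  distance, contrary to their divergence. Hence some iterate is feasible, and the first such iterate
  is reached by the algorithm.
\<close>

text \<open>
  The bound on the subgradient controls the quadratic term of the expanded square, and the gap \<open>\<sigma>\<close>
  between the function values controls the cross term.
\<close>

lemma subgradient_step_dist_decrease:
  fixes h :: "'a::real_inner \<Rightarrow> real" and a L \<sigma> :: real
  assumes subgrad: "u \<in> subdifferential h x"
    and gap: "\<sigma> \<le> h x - h s"
    and bound: "norm u \<le> L"
    and "a \<ge> 0"
  shows "(norm (x - a *\<^sub>R u - s))\<^sup>2 \<le> (norm (x - s))\<^sup>2 - a * (2 * \<sigma> - a * L\<^sup>2)"
proof -
  have "h x + (s - x) \<bullet> u \<le> h s"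
    using subgrad by (simp add: subdifferential_def)
  then have "\<sigma> \<le> (x - s) \<bullet> u"
    using gap by (simp add: inner_diff_left)
  then have cross: "a * \<sigma> \<le> a * ((x - s) \<bullet> u)"
    using \<open>a \<ge> 0\<close> by (rule mult_left_mono)
  have quadratic: "a\<^sup>2 * (norm u)\<^sup>2 \<le> a\<^sup>2 * L\<^sup>2"
    using bound by (intro mult_left_mono power_mono) auto
  have "(norm (x - a *\<^sub>R u - s))\<^sup>2 = (norm ((x - s) - a *\<^sub>R u))\<^sup>2"
    by (simp add: algebra_simps)
  also have "\<dots> = (norm (x - s))\<^sup>2 - 2 * (a * ((x - s) \<bullet> u)) + a\<^sup>2 * (norm u)\<^sup>2"
    unfolding power2_norm_eq_inner
    by (simp add: inner_diff_left inner_diff_right inner_commute power2_eq_square algebra_simps)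
  also have "\<dots> \<le> (norm (x - s))\<^sup>2 - 2 * (a * \<sigma>) + a\<^sup>2 * L\<^sup>2"
    using cross quadratic by linarith
  also have "\<dots> = (norm (x - s))\<^sup>2 - a * (2 * \<sigma> - a * L\<^sup>2)"
    by (simp add: power2_eq_square algebra_simps)
  finally show ?thesis .
qed

text \<open>
  The first iterate in \<open>C\<close> is generated, so feasibility of any entry of the sequence suffices, even of
  an arbitrary entry after the stop.
\<close>

lemma ex_generated_in:
  assumes "x k \<in> C"
  shows "\<exists>K. generated C x K \<and> x K \<in> C"
proof -
  have "x (LEAST K. x K \<in> C) \<in> C"
    using assms by (rule LeastI)
  moreover have "generated C x (LEAST K. x K \<in> C)"
    unfolding generated_def by (blast dest: not_less_Least)
  ultimately show ?thesis
    by blast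
qed

theorem theorem2p3:
  fixes m :: nat
    and f :: "nat \<Rightarrow> 'a::{real_inner, complete_space} \<Rightarrow> real"
    and I :: "nat set" and C :: "'a set"
    and L \<sigma> :: real and s :: 'a
    and \<alpha> \<delta> :: "nat \<Rightarrow> real"
  assumes "m \<ge> 1"
    and "I = {1..m}"
    and "\<And>i. i \<in> I \<Longrightarrow> convex_on UNIV (f i)"
    and "\<And>i. i \<in> I \<Longrightarrow> continuous_on UNIV (f i)"
    and "C = feasible_set I f"
    and "C \<noteq> {}"
    and "L > 0"
    and "\<And>i x u. i \<in> I \<Longrightarrow> u \<in> subdifferential (f i) x \<Longrightarrow> norm u \<le> L"
    and "Max ((\<lambda>i. f i s) ` I) < 0"
    and "\<sigma> = Min ((\<lambda>i. - f i s) ` I)"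
    and "\<And>k. \<alpha> k \<ge> 0"
    and "\<And>k. \<delta> k = \<alpha> k * (2 * \<sigma> - \<alpha> k * L\<^sup>2)"
    and "\<And>k. \<delta> k \<ge> 0"
    and "filterlim (\<lambda>n. \<Sum>k<n. \<delta> k) at_top sequentially"
  shows "\<forall>x0 \<iota> g x. subgradient_algorithm I f \<alpha> x0 \<iota> g x \<longrightarrow>
           (\<exists>K. generated C x K \<and> x K \<in> C)"
proof (intro allI impI)
  fix x0 \<iota> g x
  assume alg: "subgradient_algorithm I f \<alpha> x0 \<iota> g x"
  have "\<exists>k. x k \<in> C"
  proof (rule ccontr)
    assume "\<nexists>k. x k \<in> C"
    then have never: "generated (feasible_set I f) x k" "x k \<notin> feasible_set I f" for k
      using \<open>C = feasible_set I f\<close> by (auto simp: generated_def)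
    have step: "(norm (x (Suc k) - s))\<^sup>2 \<le> (norm (x k - s))\<^sup>2 - \<delta> k" for k
    proof -
      have idx: "\<iota> k \<in> I" and pos: "f (\<iota> k) (x k) > 0"
        and sub: "g k \<in> subdifferential (f (\<iota> k)) (x k)"
        and next_iterate: "x (Suc k) = x k - \<alpha> k *\<^sub>R g k"
        using alg never[of k] by (auto simp: subgradient_algorithm_def)
      have "\<sigma> \<le> - f (\<iota> k) s"
        using idx \<open>I = {1..m}\<close> \<open>\<sigma> = Min ((\<lambda>i. - f i s) ` I)\<close> by simp
      then have "\<sigma> \<le> f (\<iota> k) (x k) - f (\<iota> k) s"
        using pos by linarith
      from subgradient_step_dist_decrease[OF sub this assms(8)[OF idx sub] assms(11)]
      show ?thesis
        unfolding next_iterate assms(12) .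
    qed
    have bounded: "(\<Sum>k<n. \<delta> k) \<le> (norm (x 0 - s))\<^sup>2" for n
    proof -
      have "(\<Sum>k<n. \<delta> k) \<le> (\<Sum>k<n. (norm (x k - s))\<^sup>2 - (norm (x (Suc k) - s))\<^sup>2)"
        using step by (intro sum_mono) (simp add: algebra_simps)
      also have "\<dots> = (norm (x 0 - s))\<^sup>2 - (norm (x n - s))\<^sup>2"
        by (rule sum_lessThan_telescope')
      also have "\<dots> \<le> (norm (x 0 - s))\<^sup>2"
        by simp
      finally show ?thesis .
    qed
    have "\<forall>\<^sub>F n in sequentially. (norm (x 0 - s))\<^sup>2 < (\<Sum>k<n. \<delta> k)"
      using assms(14) by (simp add: filterlim_at_top_dense)
    then obtain n where "(norm (x 0 - s))\<^sup>2 < (\<Sum>k<n. \<delta> k)"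
      using eventually_happens' sequentially_bot by blast
    with bounded[of n] show False
      by linarith
  qed
  then show "\<exists>K. generated C x K \<and> x K \<in> C"
    using ex_generated_in by blast
qed

end
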